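(* Let $q=p^{e}$ with $p$ an odd prime and $e\ge 1$, and let $l$ be an integer with $0\leq l\leq e-1$ and $2l\mid e$. Let $n$ be a positive integer with $n\leq p^{l}$. Then for any integers $k,h$ with $1\leq k\leq \lfloor\frac{n}{2}\rfloor$ and $0\leq h\leq k$, there exists an $[[n,k-h,n-k+1;n-k-h]]_{q}$ MDS EAQECC.
   Context: An $[[N,K,d;c]]_q$ entanglement-assisted quantum error-correcting code (EAQECC) encodes $K$ logical qudits (of dimension $q$) into $N$ channel qudits using $c$ maximally entangled pairs shared in advance by sender and receiver, with minimum distance $d$. Formally: the sender holds $K$ information qudits, $N-K-c$ ancilla qudits in state $|0\rangle$, and her halves of $c$ maximally entangled pairs $q^{-1/2}\sum_{a\in\mathbb{F}_q}|a\rangle|a\rangle$ (the other halves being held by the receiver), and applies a unitary to her $N$ qudits; the code $Q$ is the resulting $q^K$-dimensional subspace of $(\mathbb{C}^q)^{\otimes N}\otimes(\mathbb{C}^q)^{\otimes c}$. Errors act only on the $N$ channel qudits (identity on the receiver's $c$ qudits) and have the form $\mathbf{e}=\gamma^{i}T(\mathbf{a})R(\mathbf{b})$ with $\mathbf{a},\mathbf{b}\in\mathbb{F}_q^N$, where $\gamma$ is a complex primitive $p$-th root of unity, $T(\mathbf{a})|\mathbf{v}\rangle=|\mathbf{v}+\mathbf{a}\rangle$ and $R(\mathbf{b})|\mathbf{v}\rangle=\gamma^{\mathrm{tr}_{\mathbb{F}_q/\mathbb{F}_p}(\sum_i b_iv_i)}|\mathbf{v}\rangle$; the weight of $\mathbf{e}$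 is $\#\{i:(a_i,b_i)\neq(0,0)\}$. The code has minimum distance $d$ if $d$ is the largest integer such that $\langle \mathbf{u}|\mathbf{e}|\mathbf{v}\rangle=0$ for all $|\mathbf{u}\rangle,|\mathbf{v}\rangle\in Q$ with $\langle\mathbf{u}|\mathbf{v}\rangle=0$ and all errors $\mathbf{e}$ of weight at most $d-1$ (for $K=0$, by the usual convention, the condition is instead that $\langle\mathbf{u}|\mathbf{e}|\mathbf{u}\rangle=0$ for the code state and all errors of weight between $1$ and $d-1$). An $[[N,K,d;c]]_q$ EAQECC is called MDS if $N+c-K=2(d-1)$. *)

theory Defs
  imports Complex_Main "HOL-Library.Cardinality" "HOL-Computational_Algebra.Primes" "Jordan_Normal_Form.Matrix"
begin

text \<open>
  The field with \<open>q = p ^ e\<close> elements is a type \<open>'a\<close> with \<open>CARD('a) = p ^ e\<close>, and \<open>\<gamma>\<close> is the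
  chosen complex primitive \<open>p\<close>-th root of unity.

  Computational basis states of \<open>N\<close> qudits are labelled by \<open>carrier_vec N\<close>. A state in
  \<open>(\<complex>\<^sup>q)\<^sup>\<otimes>\<^sup>N \<otimes> (\<complex>\<^sup>q)\<^sup>\<otimes>\<^sup>c\<close> (sender's \<open>N\<close> qudits, receiver's \<open>c\<close> qudits) is its coordinate
  function on pairs of labels, which vanishes outside \<open>carrier_vec N \<times> carrier_vec c\<close>.
\<close>

type_synonym 'a state = "'a vec \<times> 'a vec \<Rightarrow> complex"
type_synonym 'a operator = "'a vec \<Rightarrow> 'a vec \<Rightarrow> complex"

definition primitive_root_of_unity :: "nat \<Rightarrow> complex \<Rightarrow> bool" where
  "primitive_root_of_unity m \<gamma> \<longleftrightarrow> m > 0 \<and> \<gamma> ^ m = 1 \<and> (\<forall>j. 0 < j \<and> j < m \<longrightarrow> \<gamma> ^ j \<noteq> 1)"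

definition field_trace :: "nat \<Rightarrow> nat \<Rightarrow> 'a::field \<Rightarrow> 'a" where
  "field_trace p e x = (\<Sum>i<e. x ^ (p ^ i))"

text \<open>The trace lies in the prime field; as an exponent it is read as its representative below \<open>p\<close>.\<close>

definition trace_rep :: "nat \<Rightarrow> nat \<Rightarrow> 'a::field \<Rightarrow> nat" where
  "trace_rep p e x = (THE t. t < p \<and> of_nat t = field_trace p e x)"

definition inner_state :: "nat \<Rightarrow> nat \<Rightarrow> 'a state \<Rightarrow> 'a state \<Rightarrow> complex" where
  "inner_state N c \<phi> \<psi> = (\<Sum>x\<in>carrier_vec N \<times> carrier_vec c. cnj (\<phi> x) * \<psi> x)"

text \<open>
  An operator \<open>M\<close> on the sender's qudits is given by its entries \<open>M v u = \<langle>v|M|u\<rangle>\<close>;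
  \<open>apply_sender N M\<close> is the action of \<open>M \<otimes> I\<close>.
\<close>

definition apply_sender :: "nat \<Rightarrow> 'a operator \<Rightarrow> 'a state \<Rightarrow> 'a state" where
  "apply_sender N M \<psi> =
    (\<lambda>(v, w). if v \<in> carrier_vec N then \<Sum>u\<in>carrier_vec N. M v u * \<psi> (u, w) else 0)"

definition unitary_op :: "nat \<Rightarrow> 'a operator \<Rightarrow> bool" where
  "unitary_op N U \<longleftrightarrow>
    (\<forall>v\<in>carrier_vec N. \<forall>v'\<in>carrier_vec N.
      (\<Sum>u\<in>carrier_vec N. cnj (U u v) * U u v') = (if v = v' then 1 else 0) \<and>
      (\<Sum>u\<in>carrier_vec N. U v u * cnj (U v' u)) = (if v = v' then 1 else 0))"

definition T_op :: "'a::field vec \<Rightarrow> 'a operator" where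
  "T_op a = (\<lambda>v u. if v = u + a then 1 else 0)"

definition R_op :: "complex \<Rightarrow> nat \<Rightarrow> nat \<Rightarrow> 'a::field vec \<Rightarrow> 'a operator" where
  "R_op \<gamma> p e b = (\<lambda>v u. if v = u then \<gamma> ^ trace_rep p e (b \<bullet> u) else 0)"

definition apply_error ::
  "complex \<Rightarrow> nat \<Rightarrow> nat \<Rightarrow> nat \<Rightarrow> nat \<Rightarrow> 'a::field vec \<Rightarrow> 'a vec \<Rightarrow> 'a state \<Rightarrow> 'a state" where
  "apply_error \<gamma> p e N i a b \<psi> =
    (\<lambda>x. \<gamma> ^ i * apply_sender N (T_op a) (apply_sender N (R_op \<gamma> p e b) \<psi>) x)"

definition error_weight :: "nat \<Rightarrow> 'a::zero vec \<Rightarrow> 'a vec \<Rightarrow> nat" where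
  "error_weight N a b = card {j. j < N \<and> (a $ j, b $ j) \<noteq> (0, 0)}"

text \<open>Coordinates of the maximally entangled pair \<open>q\<^bsup>-1/2\<^esup> \<Sum>\<^sub>a |a\<rangle>|a\<rangle>\<close>.\<close>

definition max_entangled :: "'a::finite \<Rightarrow> 'a \<Rightarrow> complex" where
  "max_entangled x y = (if x = y then complex_of_real (1 / sqrt (real CARD('a))) else 0)"

text \<open>
  The sender's qudits before encoding: positions below \<open>K\<close> carry the information state \<open>\<phi>\<close>,
  positions \<open>K, \<dots>, N - c - 1\<close> are ancillas in state \<open>|0\<rangle>\<close>, and position \<open>N - c + j\<close> is
  maximally entangled with the receiver's qudit \<open>j\<close>.
\<close>

definition initial_state :: "nat \<Rightarrow> nat \<Rightarrow> nat \<Rightarrow> ('a vec \<Rightarrow> complex) \<Rightarrow> 'a::{field,finite} state" where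
  "initial_state N K c \<phi> =
    (\<lambda>(v, w). if v \<in> carrier_vec N \<and> w \<in> carrier_vec c
      then \<phi> (vec_first v K)
        * (\<Prod>j\<in>{K..<N - c}. if v $ j = 0 then 1 else 0)
        * (\<Prod>j<c. max_entangled (v $ (N - c + j)) (w $ j))
      else 0)"

definition ea_code :: "nat \<Rightarrow> nat \<Rightarrow> nat \<Rightarrow> 'a::{field,finite} operator \<Rightarrow> 'a state set" where
  "ea_code N K c U =
    {apply_sender N U (initial_state N K c \<phi>) | \<phi>. \<forall>x. x \<notin> carrier_vec K \<longrightarrow> \<phi> x = 0}"

definition detects_below ::
  "complex \<Rightarrow> nat \<Rightarrow> nat \<Rightarrow> nat \<Rightarrow> nat \<Rightarrow> nat \<Rightarrow> 'a::field state set \<Rightarrow> nat \<Rightarrow> bool" where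
  "detects_below \<gamma> p e N K c Q d \<longleftrightarrow>
    (if K = 0
     then \<forall>u\<in>Q. \<forall>i. \<forall>a\<in>carrier_vec N. \<forall>b\<in>carrier_vec N.
       1 \<le> error_weight N a b \<and> error_weight N a b < d \<longrightarrow>
         inner_state N c u (apply_error \<gamma> p e N i a b u) = 0
     else \<forall>u\<in>Q. \<forall>v\<in>Q. inner_state N c u v = 0 \<longrightarrow>
       (\<forall>i. \<forall>a\<in>carrier_vec N. \<forall>b\<in>carrier_vec N. error_weight N a b < d \<longrightarrow>
         inner_state N c u (apply_error \<gamma> p e N i a b v) = 0))"

definition has_min_distance ::
  "complex \<Rightarrow> nat \<Rightarrow> nat \<Rightarrow> nat \<Rightarrow> nat \<Rightarrow> nat \<Rightarrow> 'a::field state set \<Rightarrow> nat \<Rightarrow> bool" where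
  "has_min_distance \<gamma> p e N K c Q d \<longleftrightarrow>
    detects_below \<gamma> p e N K c Q d \<and> (\<forall>d'. detects_below \<gamma> p e N K c Q d' \<longrightarrow> d' \<le> d)"

definition is_eaqecc ::
  "complex \<Rightarrow> nat \<Rightarrow> nat \<Rightarrow> nat \<Rightarrow> nat \<Rightarrow> nat \<Rightarrow> nat \<Rightarrow> 'a::{field,finite} state set \<Rightarrow> bool" where
  "is_eaqecc \<gamma> p e N K d c Q \<longleftrightarrow>
    K + c \<le> N \<and> (\<exists>U. unitary_op N U \<and> Q = ea_code N K c U) \<and> has_min_distance \<gamma> p e N K c Q d"

definition is_mds_eaqecc ::
  "complex \<Rightarrow> nat \<Rightarrow> nat \<Rightarrow> nat \<Rightarrow> nat \<Rightarrow> nat \<Rightarrow> nat \<Rightarrow> 'a::{field,finite} state set \<Rightarrow> bool" where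
  "is_mds_eaqecc \<gamma> p e N K d c Q \<longleftrightarrow>
    is_eaqecc \<gamma> p e N K d c Q \<and> int N + int c - int K = 2 * (int d - 1)"

end

theory Submission
  imports Defs "HOL-Computational_Algebra.Polynomial"
begin

text \<open>
  Conjugating an error \<open>T(a) R(b)\<close> by the basis permutation \<open>|y\<rangle> \<mapsto> |M y\<rangle>\<close> with \<open>M\<close> invertible gives
  \<open>T(M\<^sup>-\<^sup>1 a) R(M\<^sup>T b)\<close> up to a phase. Write \<open>K = k - h\<close> and \<open>c = n - k - h\<close>, so that there are \<open>2 h\<close>
  ancillas, and let the encoder be such a permutation preceded by Fourier transforms on the first
  \<open>h\<close> ancillas. A non-zero matrix element between code states forces \<open>M\<^sup>-\<^sup>1 a\<close> to vanish on the last
  \<open>h\<close> ancillas and on the entangled positions, and \<open>M\<^sup>T b\<close> to vanish on the first \<open>h\<close> ancillas and on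
  the entangled positions. So \<open>a\<close> lies in the span of \<open>k\<close> columns of \<open>M\<close> and \<open>b\<close> is orthogonal to
  \<open>n - k\<close> columns of \<open>M\<close>. For a Vandermonde matrix with non-zero nodes and suitably permuted columns,
  both sets of columns have consecutive exponents: both codes are generalised Reed-Solomon codes of
  dimension \<open>k\<close>, hence MDS.
\<close>

section \<open>The additive character of the field\<close>

locale qudit_field =
  fixes p e :: nat and \<gamma> :: complex and field_type :: "'a::{field,finite} itself"
  assumes prime_p: "prime p" and e_pos: "e \<ge> 1" and card_field: "CARD('a) = p ^ e"
    and root_\<gamma>: "primitive_root_of_unity p \<gamma>"
begin

definition chi :: "'a \<Rightarrow> complex" where
  "chi x = \<gamma> ^ trace_rep p e x"

section \<open>Characteristic, prime field and field trace\<close>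

lemma p_gt_1: "p > 1"
  using prime_p prime_gt_1_nat by blast

text \<open>Translation by 1 permutes the field, so comparing the sums of all elements gives
  \<open>p ^ e = 0\<close> in the field. The characteristic is thus a prime dividing
  \<open>p ^ e\<close>.\<close>

lemma char_field: "CHAR('a) = p"
proof -
  have "(\<Sum>x\<in>UNIV. x) = (\<Sum>x\<in>UNIV. x + 1 :: 'a)"
    by (rule sum.reindex_bij_witness[of _ "\<lambda>x. x + 1" "\<lambda>x. x - 1"]) auto
  also have "\<dots> = (\<Sum>x\<in>UNIV. x) + of_nat CARD('a)"
    by (simp add: sum.distrib)
  finally have "CHAR('a) dvd p ^ e"
    by (simp add: card_field of_nat_eq_0_iff_char_dvd del: of_nat_power)
  moreover have "prime CHAR('a)"
    by (intro prime_CHAR_semidom finite_imp_CHAR_pos) simp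
  ultimately show ?thesis
    using prime_dvd_power primes_dvd_imp_eq prime_p by metis
qed

text \<open>Multiplication by a non-zero \<open>x\<close> permutes the non-zero elements; comparing
  their products gives \<open>x ^ (p ^ e - 1) = 1\<close>.\<close>

lemma power_card_field: "x ^ (p ^ e) = (x :: 'a)"
proof (cases "x = 0")
  case False
  have "(\<Prod>y\<in>UNIV - {0}. y) = (\<Prod>y\<in>UNIV - {0}. x * y)"
    by (rule prod.reindex_bij_witness[of _ "\<lambda>y. x * y" "\<lambda>y. y / x"]) (use False in auto)
  also have "\<dots> = x ^ (p ^ e - 1) * (\<Prod>y\<in>UNIV - {0}. y)"
    by (simp add: prod.distrib card_field card_Diff_singleton)
  finally have "x ^ (p ^ e - 1) = 1"
    by simp
  then show ?thesis
    using p_gt_1 power_minus_mult[of "p ^ e" x] by simp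
qed (use p_gt_1 in simp)

lemma frobenius_sum: "(\<Sum>i\<in>I. f i :: 'a) ^ (p ^ k) = (\<Sum>i\<in>I. f i ^ (p ^ k))"
  by (rule freshmans_dream_sum') (simp_all add: char_field prime_p)

lemma inj_of_nat_field: "inj_on (of_nat :: nat \<Rightarrow> 'a) {..<p}"
proof (rule linorder_inj_onI)
  fix s t :: nat assume "s < t" "s \<in> {..<p}" "t \<in> {..<p}"
  then have "\<not> p dvd t - s"
    using dvd_imp_le[of p "t - s"] by auto
  then have "of_nat (t - s) \<noteq> (0 :: 'a)"
    by (simp add: of_nat_eq_0_iff_char_dvd char_field del: of_nat_diff)
  then show "of_nat s \<noteq> (of_nat t :: 'a)"
    using \<open>s < t\<close> by simp
qed auto

text \<open>The polynomial X^p - X has at most \<open>p\<close> roots, and the images of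
  \<open>0, ..., p - 1\<close> are already \<open>p\<close> distinct ones.\<close>

lemma prime_field:
  assumes "x ^ p = (x :: 'a)"
  shows "\<exists>t<p. of_nat t = x"
proof -
  define P :: "'a poly" where "P = monom 1 p - monom 1 1"
  have "coeff P p = 1"
    using p_gt_1 by (simp add: P_def)
  then have P: "P \<noteq> 0" by auto
  have deg: "degree P \<le> p"
    unfolding P_def using p_gt_1 by (intro degree_diff_le) (auto simp: degree_monom_eq)
  have root: "poly P y = 0 \<longleftrightarrow> y ^ p = y" for y
    by (simp add: P_def poly_monom)
  have "(of_nat t :: 'a) ^ p = of_nat t" for t
    using frobenius_sum[of "\<lambda>_. 1" "{..<t}" 1] by simp
  then have "of_nat ` {..<p} \<subseteq> {y. poly P y = 0}"
    by (auto simp: root)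
  moreover have "card {y. poly P y = 0} \<le> card ((of_nat :: nat \<Rightarrow> 'a) ` {..<p})"
    using card_poly_roots_bound[OF P] deg by (simp add: card_image inj_of_nat_field)
  ultimately have "of_nat ` {..<p} = {y. poly P y = 0}"
    using poly_roots_finite[OF P] card_seteq by blast
  then show ?thesis
    using assms root by (metis (mono_tags, lifting) imageE lessThan_iff mem_Collect_eq)
qed

text \<open>The Frobenius map permutes the summands cyclically, since
  \<open>x ^ (p ^ e) = x\<close>. With \<open>prime_field\<close> this places the trace in the prime
  field.\<close>

lemma field_trace_power: "field_trace p e x ^ p = field_trace p e (x :: 'a)"
proof -
  have "field_trace p e x ^ p = (\<Sum>i<e. x ^ (p ^ Suc i))"
    using frobenius_sum[of "\<lambda>i. x ^ (p ^ i)" "{..<e}" 1]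
    by (simp add: field_trace_def mult.commute flip: power_mult)
  also have "\<dots> + x = (\<Sum>i<Suc e. x ^ (p ^ i))"
    by (subst sum.lessThan_Suc_shift) simp
  also have "\<dots> = field_trace p e x + x"
    by (simp add: field_trace_def power_card_field)
  finally show ?thesis by simp
qed

lemma field_trace_add: "field_trace p e (x + y) = field_trace p e x + field_trace p e (y :: 'a)"
  using freshmans_dream'[where 'a = 'a] prime_p
  by (simp add: field_trace_def char_field sum.distrib)

text \<open>The trace is a polynomial function of degree below the field size. The coefficient of X
  is 1, so the polynomial is non-zero and cannot vanish everywhere.\<close>

lemma field_trace_nonzero: "\<exists>x :: 'a. field_trace p e x \<noteq> 0"
proof -
  define P :: "'a poly" where "P = (\<Sum>i<e. monom 1 (p ^ i))"
  have "coeff P (p ^ 0) = (\<Sum>i<e. if i = 0 then 1 else 0)"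
    unfolding P_def coeff_sum using p_gt_1 by (intro sum.cong) auto
  then have P: "P \<noteq> 0"
    using e_pos by auto
  have "degree P \<le> p ^ (e - 1)"
    unfolding P_def using p_gt_1
    by (intro degree_sum_le) (auto simp: degree_monom_eq intro!: power_increasing)
  also have "\<dots> < p ^ e"
    using p_gt_1 e_pos by (intro power_strict_increasing) auto
  finally have "card {x. poly P x = 0} < CARD('a)"
    using card_poly_roots_bound[OF P] by (simp add: card_field)
  then have "{x. poly P x = 0} \<noteq> UNIV" by force
  moreover have "poly P x = field_trace p e x" for x
    by (simp add: P_def poly_sum poly_monom field_trace_def)
  ultimately show ?thesis by auto
qed

text \<open>Existence and uniqueness of the representative, which the definite description in
  \<open>trace_rep\<close> relies on.\<close>

lemma trace_rep:
  "trace_rep p e x < p" "of_nat (trace_rep p e x) = field_trace p e (x :: 'a)"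
proof -
  have "\<exists>!t. t < p \<and> of_nat t = field_trace p e x"
    using prime_field[OF field_trace_power] inj_of_nat_field
    by (auto simp: inj_on_def)
  then show "trace_rep p e x < p" "of_nat (trace_rep p e x) = field_trace p e x"
    unfolding trace_rep_def using theI'[of "\<lambda>t. t < p \<and> of_nat t = field_trace p e x"] by auto
qed

section \<open>The additive character and its orthogonality relation\<close>

lemma \<gamma>_power_mod: "\<gamma> ^ (m mod p) = \<gamma> ^ m"
proof -
  have "\<gamma> ^ m = \<gamma> ^ (p * (m div p) + m mod p)" by simp
  also have "\<dots> = \<gamma> ^ (m mod p)"
    using root_\<gamma> unfolding power_add power_mult by (simp add: primitive_root_of_unity_def)
  finally show ?thesis by simp
qed

lemma \<gamma>_nonzero: "\<gamma> \<noteq> 0"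
  using root_\<gamma> by (auto simp: primitive_root_of_unity_def power_0_left)

text \<open>Representatives of traces add only modulo \<open>p\<close>, which suffices because
  \<open>\<gamma> ^ p = 1\<close>.\<close>

lemma chi_add: "chi (x + y) = chi x * chi y"
proof -
  have "of_nat ((trace_rep p e x + trace_rep p e y) mod p) = (of_nat (trace_rep p e (x + y)) :: 'a)"
    using of_nat_CHAR[where 'a = 'a] unfolding char_field
    by (metis (no_types, lifting) field_trace_add mod_mult_div_eq mult_zero_left
        of_nat_add of_nat_mult trace_rep(2) add.right_neutral)
  then have "(trace_rep p e x + trace_rep p e y) mod p = trace_rep p e (x + y)"
    using inj_of_nat_field trace_rep(1) p_gt_1 by (auto simp: inj_on_def)
  then show ?thesis
    unfolding chi_def by (metis \<gamma>_power_mod power_add)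
qed

lemma chi_0 [simp]: "chi 0 = 1"
  using chi_add[of 0 0] \<gamma>_nonzero by (simp add: chi_def)

lemma chi_sum: "chi (\<Sum>i\<in>I. f i) = (\<Prod>i\<in>I. chi (f i))"
  by (induction I rule: infinite_finite_induct) (auto simp: chi_add)

text \<open>Character values have modulus 1, so conjugate and inverse coincide.\<close>

lemma cnj_chi: "cnj (chi x) = chi (- x)"
proof -
  have "norm \<gamma> ^ p = 1"
    using root_\<gamma> by (metis norm_one norm_power primitive_root_of_unity_def)
  then have "norm \<gamma> = 1"
    using p_gt_1 power_eq_1_iff[of "norm \<gamma>" p] by simp
  then have "norm (chi x) = 1"
    by (simp add: chi_def norm_power)
  then have "chi x * cnj (chi x) = chi x * chi (- x)"
    using complex_norm_square[of "chi x"] by (simp flip: chi_add)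
  moreover have "chi x \<noteq> 0"
    using \<open>norm (chi x) = 1\<close> by auto
  ultimately show ?thesis by simp
qed

lemma chi_nontrivial: "\<exists>x. chi x \<noteq> 1"
proof -
  obtain x where "field_trace p e x \<noteq> (0 :: 'a)"
    using field_trace_nonzero by blast
  then have "trace_rep p e x \<noteq> 0"
    using trace_rep(2)[of x] by (metis of_nat_0)
  then have "chi x \<noteq> 1"
    using root_\<gamma> trace_rep(1)[of x] by (auto simp: chi_def primitive_root_of_unity_def)
  then show ?thesis ..
qed

text \<open>For \<open>c \<noteq> 0\<close>, translating the summation variable by
  \<open>y / c\<close> multiplies the sum by \<open>chi y\<close>, and \<open>y\<close> can be
  chosen with \<open>chi y \<noteq> 1\<close>.\<close>

lemma sum_chi: "(\<Sum>x\<in>UNIV. chi (c * x)) = (if c = 0 then of_nat CARD('a) else 0)"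
proof (cases "c = 0")
  case False
  obtain y where y: "chi y \<noteq> 1"
    using chi_nontrivial by blast
  have "(\<Sum>x\<in>UNIV. chi (c * x)) = (\<Sum>x\<in>UNIV. chi (c * (x + y / c)))"
    by (rule sum.reindex_bij_witness[of _ "\<lambda>x. x + y / c" "\<lambda>x. x - y / c"]) auto
  also have "\<dots> = chi y * (\<Sum>x\<in>UNIV. chi (c * x))"
    using False by (simp add: distrib_left chi_add sum_distrib_left mult.commute)
  finally show ?thesis
    using y False by simp
qed simp

end

section \<open>Sums over coordinate vectors\<close>

lemma sum_carrier_vec_Suc:
  "(\<Sum>y\<in>carrier_vec (Suc n). F y) =
    (\<Sum>z\<in>carrier_vec n. \<Sum>x\<in>UNIV. F (vec (Suc n) (\<lambda>i. if i < n then z $ i else x)))"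
  unfolding sum.cartesian_product
  by (rule sum.reindex_bij_witness[of _
        "\<lambda>(z, x). vec (Suc n) (\<lambda>i. if i < n then z $ i else x)" "\<lambda>y. (vec_first y n, y $ n)"])
     (auto simp: vec_first_def less_Suc_eq intro!: arg_cong[of _ _ F])

lemma carrier_vec_0_eq: "carrier_vec 0 = {vNil}"
  by auto

text \<open>Distributivity, one coordinate at a time. It reduces sums over basis labels to a sum
  over information labels and independent sums over single coordinates.\<close>

lemma sum_carrier_vec_split:
  fixes f :: "'a::finite vec \<Rightarrow> 'b::comm_semiring_1"
  assumes "K \<le> n"
  shows "(\<Sum>y\<in>carrier_vec n. f (vec_first y K) * (\<Prod>j\<in>{K..<n}. g j (y $ j))) =
    (\<Sum>z\<in>carrier_vec K. f z) * (\<Prod>j\<in>{K..<n}. \<Sum>x\<in>UNIV. g j x)"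
  using assms
proof (induction n rule: dec_induct)
  case base
  have "vec_first y K = y" if "y \<in> carrier_vec K" for y :: "'a vec"
    using that by (auto simp: vec_first_def)
  then show ?case by simp
next
  case (step n)
  let ?v = "\<lambda>z x. vec (Suc n) (\<lambda>i. if i < n then z $ i else x)"
  have "f (vec_first (?v z x) K) * (\<Prod>j\<in>{K..<Suc n}. g j (?v z x $ j)) =
      f (vec_first z K) * (\<Prod>j\<in>{K..<n}. g j (z $ j)) * g n x" for z :: "'a vec" and x
  proof -
    have "vec_first (?v z x) K = vec_first z K"
      using step.hyps by (auto simp: vec_first_def)
    moreover have "(\<Prod>j\<in>{K..<n}. g j (?v z x $ j)) = (\<Prod>j\<in>{K..<n}. g j (z $ j))"
      by (rule prod.cong) auto
    ultimately show ?thesis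
      using step.hyps by (simp add: mult.assoc)
  qed
  then have "(\<Sum>y\<in>carrier_vec (Suc n). f (vec_first y K) * (\<Prod>j\<in>{K..<Suc n}. g j (y $ j))) =
      (\<Sum>z\<in>carrier_vec n. \<Sum>x\<in>UNIV. f (vec_first z K) * (\<Prod>j\<in>{K..<n}. g j (z $ j)) * g n x)"
    by (simp only: sum_carrier_vec_Suc)
  also have "\<dots> = (\<Sum>z\<in>carrier_vec n. f (vec_first z K) * (\<Prod>j\<in>{K..<n}. g j (z $ j))) *
      (\<Sum>x\<in>UNIV. g n x)"
    by (simp add: sum_product)
  finally show ?case
    using step by (simp add: mult.assoc)
qed

lemma sum_carrier_vec_prod:
  fixes g :: "nat \<Rightarrow> 'a::finite \<Rightarrow> 'b::comm_semiring_1"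
  shows "(\<Sum>y\<in>carrier_vec n. \<Prod>j<n. g j (y $ j)) = (\<Prod>j<n. \<Sum>x\<in>UNIV. g j x)"
  using sum_carrier_vec_split[of 0 n "\<lambda>_. 1" g] by (simp add: carrier_vec_0_eq atLeast0LessThan)

lemma finite_carrier_vec [simp]: "finite (carrier_vec n :: 'a::finite vec set)"
proof (induction n)
  case (Suc n)
  have "carrier_vec (Suc n) \<subseteq> (\<lambda>(z :: 'a vec, x). vec (Suc n) (\<lambda>i. if i < n then z $ i else x)) `
      (carrier_vec n \<times> UNIV)"
  proof
    fix y :: "'a vec" assume "y \<in> carrier_vec (Suc n)"
    then show "y \<in> (\<lambda>(z :: 'a vec, x). vec (Suc n) (\<lambda>i. if i < n then z $ i else x)) `
      (carrier_vec n \<times> UNIV)"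
      by (intro image_eqI[of _ _ "(vec_first y n, y $ n)"]) (auto simp: vec_first_def less_Suc_eq)
  qed
  then show ?case
    using Suc by (auto intro: finite_subset)
qed (simp add: carrier_vec_0_eq)

lemma prod_if_ball:
  assumes "finite I"
  shows "(\<Prod>j\<in>I. if P j then 1 else 0 :: 'b::comm_semiring_1) = (if \<forall>j\<in>I. P j then 1 else 0)"
  using assms by (induction I rule: finite_induct) auto

lemma prod_split_at:
  fixes f :: "nat \<Rightarrow> 'b::comm_monoid_mult"
  assumes "a \<le> b"
  shows "(\<Prod>j\<in>{a..<b + d}. f j) = (\<Prod>j\<in>{a..<b}. f j) * (\<Prod>j<d. f (b + j))"
  using assms prod.atLeastLessThan_concat[of a b "b + d" f] prod.atLeastLessThan_shift_0[of f b "b + d"]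
  by (simp add: atLeast0LessThan)

section \<open>Clifford encoders of CSS type\<close>

locale css_encoder = qudit_field p e \<gamma> field_type
  for p e :: nat and \<gamma> :: complex and field_type :: "'a::{field,finite} itself" +
  fixes K h c n :: nat and M :: "'a mat"
  assumes n_eq: "n = K + 2 * h + c"
    and M_carrier: "M \<in> carrier_mat n n"
    and inj_M: "inj_on (\<lambda>y. M *\<^sub>v y) (carrier_vec n)"
begin

definition enc :: "'a vec \<Rightarrow> 'a vec" where
  "enc y = M *\<^sub>v y"

definition dec :: "'a vec \<Rightarrow> 'a vec" where
  "dec = inv_into (carrier_vec n) enc"

definition gate :: "nat \<Rightarrow> 'a \<Rightarrow> 'a \<Rightarrow> complex" where
  "gate j x y = (if K \<le> j \<and> j < K + h then chi (x * y) * complex_of_real (1 / sqrt (real CARD('a)))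
    else if x = y then 1 else 0)"

text \<open>
  \<^const>\<open>gate\<close> sends the ancilla state \<open>|0\<rangle>\<close> to the uniform superposition, so these positions detect phase
  errors instead of shifts.
\<close>

definition encoding_unitary :: "'a operator" where
  "encoding_unitary w u = (\<Prod>j<n. gate j (dec w $ j) (u $ j))"

definition code_state :: "('a vec \<Rightarrow> complex) \<Rightarrow> 'a state" where
  "code_state \<phi> = apply_sender n encoding_unitary (initial_state n K c \<phi>)"

section \<open>The encoding permutation and unitarity of the encoder\<close>

lemma enc_carrier [simp]: "y \<in> carrier_vec n \<Longrightarrow> enc y \<in> carrier_vec n"
  using M_carrier by (simp add: enc_def)

lemma bij_enc: "bij_betw enc (carrier_vec n) (carrier_vec n)"
proof -
  have "inj_on enc (carrier_vec n)"
    using inj_M by (simp add: enc_def[abs_def])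
  moreover have "enc ` carrier_vec n \<subseteq> carrier_vec n" by auto
  ultimately show ?thesis
    by (simp add: bij_betw_def endo_inj_surj)
qed

lemma dec_enc [simp]: "y \<in> carrier_vec n \<Longrightarrow> dec (enc y) = y"
  unfolding dec_def by (meson bij_betw_inv_into_left bij_enc)

lemma enc_dec [simp]: "w \<in> carrier_vec n \<Longrightarrow> enc (dec w) = w"
  unfolding dec_def by (meson bij_betw_inv_into_right bij_enc)

lemma dec_carrier [simp]: "w \<in> carrier_vec n \<Longrightarrow> dec w \<in> carrier_vec n"
  unfolding dec_def by (metis bij_betw_def bij_enc inv_into_into)

lemma enc_add: "x \<in> carrier_vec n \<Longrightarrow> y \<in> carrier_vec n \<Longrightarrow> enc (x + y) = enc x + enc y"
  using M_carrier by (simp add: enc_def mult_add_distrib_mat_vec)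

lemma enc_0 [simp]: "enc (0\<^sub>v n) = 0\<^sub>v n"
  using M_carrier by (auto simp: enc_def)

lemma sqrt_card: "complex_of_real (1 / sqrt (real CARD('a))) * complex_of_real (1 / sqrt (real CARD('a)))
    = 1 / of_nat CARD('a)"
  by (simp flip: of_real_mult)

lemma gate_unitary:
  "(\<Sum>u\<in>UNIV. cnj (gate j u x) * gate j u y) = (if x = y then 1 else 0)"
  "(\<Sum>u\<in>UNIV. gate j x u * cnj (gate j y u)) = (if x = y then 1 else 0)"
proof -
  have chi1: "cnj (chi (u * x)) * chi (u * y) = chi ((y - x) * u)" for u
    by (simp add: cnj_chi algebra_simps flip: chi_add)
  have chi2: "chi (x * u) * cnj (chi (y * u)) = chi ((x - y) * u)" for u
    by (simp add: cnj_chi algebra_simps flip: chi_add)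
  let ?s = "complex_of_real (1 / sqrt (real CARD('a)))"
  show "(\<Sum>u\<in>UNIV. cnj (gate j u x) * gate j u y) = (if x = y then 1 else 0)"
  proof (cases "K \<le> j \<and> j < K + h")
    case True
    then have "cnj (gate j u x) * gate j u y = cnj (chi (u * x)) * chi (u * y) * (?s * ?s)" for u
      by (simp add: gate_def)
    then show ?thesis
      unfolding chi1 sqrt_card by (simp only: sum_chi flip: sum_distrib_right) auto
  next
    case False
    then have "cnj (gate j u x) * gate j u y = (if u = x then if x = y then 1 else 0 else 0)" for u
      by (auto simp: gate_def)
    then show ?thesis by simp
  qed
  show "(\<Sum>u\<in>UNIV. gate j x u * cnj (gate j y u)) = (if x = y then 1 else 0)"
  proof (cases "K \<le> j \<and> j < K + h")
    case True
    then have "gate j x u * cnj (gate j y u) = chi (x * u) * cnj (chi (y * u)) * (?s * ?s)" for u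
      by (simp add: gate_def)
    then show ?thesis
      unfolding chi2 sqrt_card by (simp only: sum_chi flip: sum_distrib_right) auto
  next
    case False
    then have "gate j x u * cnj (gate j y u) = (if u = x then if x = y then 1 else 0 else 0)" for u
      by (auto simp: gate_def)
    then show ?thesis by simp
  qed
qed

lemma prod_eq_vec:
  assumes "x \<in> carrier_vec m" "y \<in> carrier_vec m"
  shows "(\<Prod>j<m. if x $ j = y $ j then 1 else 0 :: complex) = (if x = y then 1 else 0)"
  using assms by (simp add: prod_if_ball vec_eq_iff)

text \<open>The encoder is the tensor product of the gates followed by the basis permutation
  \<open>enc\<close>, which \<open>dec\<close> undoes in the row index. After reindexing along
  \<open>enc\<close> where needed, both sums factor into the sums of
  \<open>gate_unitary\<close>.\<close>

lemma unitary_encoding: "unitary_op n encoding_unitary"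
  unfolding unitary_op_def
proof (intro ballI conjI)
  fix v v' :: "'a vec" assume v: "v \<in> carrier_vec n" "v' \<in> carrier_vec n"
  have "(\<Sum>u\<in>carrier_vec n. cnj (encoding_unitary u v) * encoding_unitary u v') =
      (\<Sum>y\<in>carrier_vec n. cnj (encoding_unitary (enc y) v) * encoding_unitary (enc y) v')"
    by (rule sum.reindex_bij_betw[OF bij_enc, symmetric])
  also have "\<dots> = (\<Sum>y\<in>carrier_vec n. \<Prod>j<n. cnj (gate j (y $ j) (v $ j)) * gate j (y $ j) (v' $ j))"
    by (intro sum.cong) (simp_all add: encoding_unitary_def prod.distrib)
  also have "\<dots> = (if v = v' then 1 else 0)"
    using v by (subst sum_carrier_vec_prod[of "\<lambda>j x. cnj (gate j x (v $ j)) * gate j x (v' $ j)"])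
      (simp add: gate_unitary prod_eq_vec)
  finally show "(\<Sum>u\<in>carrier_vec n. cnj (encoding_unitary u v) * encoding_unitary u v') =
      (if v = v' then 1 else 0)" .
  have "(\<Sum>u\<in>carrier_vec n. encoding_unitary v u * cnj (encoding_unitary v' u)) =
      (\<Sum>u\<in>carrier_vec n. \<Prod>j<n. gate j (dec v $ j) (u $ j) * cnj (gate j (dec v' $ j) (u $ j)))"
    by (simp add: encoding_unitary_def prod.distrib)
  also have "\<dots> = (if dec v = dec v' then 1 else 0)"
    using v by (subst sum_carrier_vec_prod[of "\<lambda>j x. gate j (dec v $ j) x * cnj (gate j (dec v' $ j) x)"])
      (simp add: gate_unitary prod_eq_vec)
  also have "dec v = dec v' \<longleftrightarrow> v = v'"
    using v by (metis enc_dec)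
  finally show "(\<Sum>u\<in>carrier_vec n. encoding_unitary v u * cnj (encoding_unitary v' u)) =
      (if v = v' then 1 else 0)" .
qed

text \<open>Single-position amplitudes after the gates, with receiver label \<open>r\<close>:
  uniform on the first \<open>h\<close> ancillas, concentrated at 0 on the last \<open>h\<close>,
  and correlated with \<open>r\<close> on the entangled positions.\<close>

definition amp :: "'a vec \<Rightarrow> nat \<Rightarrow> 'a \<Rightarrow> complex" where
  "amp r j x = (if j < K + h then complex_of_real (1 / sqrt (real CARD('a)))
    else if j < n - c then if x = 0 then 1 else 0
    else max_entangled x (r $ (j - (n - c))))"

lemma code_state_enc:
  assumes y: "y \<in> carrier_vec n" and r: "r \<in> carrier_vec c"
  shows "code_state \<phi> (enc y, r) = \<phi> (vec_first y K) * (\<Prod>j\<in>{K..<n}. amp r j (y $ j))"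
proof -
  define ini where "ini j x = (if j < n - c then if x = 0 then 1 else 0
    else max_entangled x (r $ (j - (n - c))))" for j and x :: 'a
  have nc: "n = n - c + c" "K \<le> n - c" "K \<le> n" using n_eq by auto
  have ini: "initial_state n K c \<phi> (u, r) = \<phi> (vec_first u K) * (\<Prod>j\<in>{K..<n}. ini j (u $ j))"
    if "u \<in> carrier_vec n" for u
  proof -
    have "(\<Prod>j\<in>{K..<n}. ini j (u $ j)) =
        (\<Prod>j\<in>{K..<n - c}. ini j (u $ j)) * (\<Prod>j<c. ini (n - c + j) (u $ (n - c + j)))"
      using prod_split_at[OF nc(2), of "\<lambda>j. ini j (u $ j)" c] nc(1) by simp
    also have "\<dots> = (\<Prod>j\<in>{K..<n - c}. if u $ j = 0 then 1 else 0) *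
        (\<Prod>j<c. max_entangled (u $ (n - c + j)) (r $ j))"
      by (intro arg_cong2[of _ _ _ _ "(*)"] prod.cong) (auto simp: ini_def)
    finally show ?thesis
      using that r by (simp add: initial_state_def mult.assoc)
  qed
  \<comment> \<open>The gates are identities on the information positions, so these contribute a
    Kronecker delta that later selects the label \<open>vec_first y K\<close>.\<close>
  have gates: "(\<Prod>j<n. gate j (y $ j) (u $ j)) =
      (if vec_first y K = vec_first u K then 1 else 0) * (\<Prod>j\<in>{K..<n}. gate j (y $ j) (u $ j))" for u
  proof -
    have "(\<Prod>j<n. gate j (y $ j) (u $ j)) =
        (\<Prod>j<K. gate j (y $ j) (u $ j)) * (\<Prod>j\<in>{K..<n}. gate j (y $ j) (u $ j))"
      using prod.atLeastLessThan_concat[of 0 K n "\<lambda>j. gate j (y $ j) (u $ j)"] nc(3)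
      by (simp add: atLeast0LessThan)
    also have "(\<Prod>j<K. gate j (y $ j) (u $ j)) =
        (\<Prod>j<K. if vec_first y K $ j = vec_first u K $ j then 1 else 0)"
      by (intro prod.cong) (auto simp: gate_def vec_first_def)
    finally show ?thesis by (simp add: prod_eq_vec)
  qed
  have sum_gate: "(\<Sum>x\<in>UNIV. gate j (y $ j) x * ini j x) = amp r j (y $ j)" if "K \<le> j" for j
  proof (cases "j < K + h")
    case True
    then have "gate j (y $ j) x * ini j x =
        (if x = 0 then complex_of_real (1 / sqrt (real CARD('a))) else 0)" for x
      using that n_eq by (auto simp: gate_def ini_def)
    then show ?thesis using True by (simp add: amp_def)
  next
    case False
    then have "gate j (y $ j) x * ini j x = (if y $ j = x then amp r j x else 0)" for x
      by (auto simp: gate_def ini_def amp_def)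
    then show ?thesis by simp
  qed
  have "code_state \<phi> (enc y, r) = (\<Sum>u\<in>carrier_vec n.
      (\<lambda>z. \<phi> z * (if vec_first y K = z then 1 else 0)) (vec_first u K) *
      (\<Prod>j\<in>{K..<n}. (\<lambda>j x. gate j (y $ j) x * ini j x) j (u $ j)))"
    using y by (auto simp: code_state_def apply_sender_def encoding_unitary_def gates ini
        prod.distrib intro!: sum.cong)
  also have "\<dots> = (\<Sum>z\<in>carrier_vec K. \<phi> z * (if vec_first y K = z then 1 else 0)) *
      (\<Prod>j\<in>{K..<n}. \<Sum>x\<in>UNIV. gate j (y $ j) x * ini j x)"
    by (rule sum_carrier_vec_split) (use nc in simp)
  also have "(\<Sum>z\<in>carrier_vec K. \<phi> z * (if vec_first y K = z then 1 else 0)) = \<phi> (vec_first y K)"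
    by (simp add: if_distrib cong: if_cong)
  also have "(\<Prod>j\<in>{K..<n}. \<Sum>x\<in>UNIV. gate j (y $ j) x * ini j x) = (\<Prod>j\<in>{K..<n}. amp r j (y $ j))"
    by (intro prod.cong) (auto simp: sum_gate)
  finally show ?thesis .
qed

section \<open>Matrix elements of errors between code states\<close>

lemma position_bounds: "K \<le> n" "K + h \<le> n" "K + h \<le> n - c" "n - c \<le> n"
  using n_eq by auto

text \<open>For \<open>K \<le> j\<close>, this is the condition that position \<open>j\<close> does
  not annihilate the matrix element of the error with shift \<open>enc x\<close> and phase vector
  \<open>b\<close>. Entangled positions impose both constraints, each ancilla only one.\<close>

definition undetected :: "'a vec \<Rightarrow> 'a vec \<Rightarrow> nat \<Rightarrow> bool" where
  "undetected x b j \<longleftrightarrow>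
    (K + h \<le> j \<longrightarrow> x $ j = 0) \<and> (j < K + h \<or> n - c \<le> j \<longrightarrow> (M\<^sup>T *\<^sub>v b) $ j = 0)"

lemma apply_error_code_state:
  assumes v: "v \<in> carrier_vec n" and a: "a \<in> carrier_vec n"
  shows "apply_error \<gamma> p e n i a b (code_state \<psi>) (v, r) =
    \<gamma> ^ i * (chi (b \<bullet> (v - a)) * code_state \<psi> (v - a, r))"
proof -
  have R: "apply_sender n (R_op \<gamma> p e b) (code_state \<psi>) (u, r) = chi (b \<bullet> u) * code_state \<psi> (u, r)"
    if "u \<in> carrier_vec n" for u
    using that by (simp add: apply_sender_def R_op_def chi_def if_distrib[of "\<lambda>x. x * _"] cong: if_cong)
  have shift: "v = u + a \<longleftrightarrow> u = v - a" if "u \<in> carrier_vec n" for u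
    using that v a by (auto simp: vec_eq_iff)
  have "apply_sender n (T_op a) (apply_sender n (R_op \<gamma> p e b) (code_state \<psi>)) (v, r) =
      (\<Sum>u\<in>carrier_vec n. if u = v - a then chi (b \<bullet> u) * code_state \<psi> (u, r) else 0)"
    using v unfolding apply_sender_def[of n "T_op a"] by (simp add: T_op_def R shift if_distrib[of "\<lambda>x. x * _"] cong: if_cong)
  then show ?thesis
    using v a by (simp add: apply_error_def)
qed

text \<open>Summing out the receiver's register: each entangled pair forces the two sender labels to
  agree and leaves a factor \<open>1 / q\<close>, where \<open>q\<close> is the field size. The
  first \<open>h\<close> ancillas contribute the same factor without a constraint.\<close>

lemma sum_amp:
  "(\<Sum>r\<in>carrier_vec c. (\<Prod>j\<in>{K..<n}. cnj (amp r j (x $ j)) * amp r j (y $ j))) =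
    (\<Prod>j\<in>{K..<n}. if j < K + h then 1 / of_nat CARD('a)
      else if j < n - c then (if x $ j = 0 then 1 else 0) * (if y $ j = 0 then 1 else 0)
      else (if x $ j = y $ j then 1 / of_nat CARD('a) else 0))"
proof -
  have nc: "n = n - c + c" "K \<le> n - c" "K + h \<le> n - c" using n_eq by auto
  define A :: "nat \<Rightarrow> complex" where "A j = (if j < K + h then 1 / of_nat CARD('a)
      else (if x $ j = 0 then 1 else 0) * (if y $ j = 0 then 1 else 0))" for j
  define B where "B j z = max_entangled (x $ (n - c + j)) z * max_entangled (y $ (n - c + j)) z"
    for j and z :: 'a
  have cnj_amp: "cnj (amp r j z) = amp r j z" for r j z
    by (simp add: amp_def max_entangled_def)
  have split: "(\<Prod>j\<in>{K..<n}. f j) = (\<Prod>j\<in>{K..<n - c}. f j) * (\<Prod>j<c. f (n - c + j))" for f :: "nat \<Rightarrow> complex"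
    using prod_split_at[OF nc(2), of f c] nc(1) by simp
  have sum_B: "(\<Sum>z\<in>UNIV. B j z) = (if x $ (n - c + j) = y $ (n - c + j) then 1 / of_nat CARD('a) else 0)" for j
  proof -
    have "B j z = (if z = x $ (n - c + j) then
        if x $ (n - c + j) = y $ (n - c + j) then 1 / of_nat CARD('a) else 0 else 0)" for z
      by (auto simp: B_def max_entangled_def sqrt_card simp del: of_real_divide of_real_mult)
    then show ?thesis by simp
  qed
  have "(\<Prod>j\<in>{K..<n}. cnj (amp r j (x $ j)) * amp r j (y $ j)) =
      (\<Prod>j\<in>{K..<n - c}. A j) * (\<Prod>j<c. B j (r $ j))" for r
    unfolding split cnj_amp
    using nc(3) by (intro arg_cong2[of _ _ _ _ "(*)"] prod.cong)
      (auto simp: amp_def A_def B_def sqrt_card simp del: of_real_divide of_real_mult)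
  then have "(\<Sum>r\<in>carrier_vec c. (\<Prod>j\<in>{K..<n}. cnj (amp r j (x $ j)) * amp r j (y $ j))) =
      (\<Prod>j\<in>{K..<n - c}. A j) * (\<Prod>j<c. \<Sum>z\<in>UNIV. B j z)"
    by (simp add: sum_carrier_vec_prod flip: sum_distrib_left)
  also have "\<dots> = (\<Prod>j\<in>{K..<n - c}. A j) *
      (\<Prod>j<c. if x $ (n - c + j) = y $ (n - c + j) then 1 / of_nat CARD('a) else 0)"
    by (simp only: sum_B)
  also have "\<dots> =
      (\<Prod>j\<in>{K..<n}. if j < K + h then 1 / of_nat CARD('a)
      else if j < n - c then (if x $ j = 0 then 1 else 0) * (if y $ j = 0 then 1 else 0)
      else (if x $ j = y $ j then 1 / of_nat CARD('a) else 0))"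
    unfolding split using nc(3) by (intro arg_cong2[of _ _ _ _ "(*)"] prod.cong) (auto simp: A_def)
  finally show ?thesis .
qed

text \<open>Transposing \<open>M\<close> moves the phase vector to the unencoded coordinates, where
  the character splits into one factor per position.\<close>

lemma chi_enc:
  assumes y: "y \<in> carrier_vec n" and b: "b \<in> carrier_vec n"
  shows "chi (b \<bullet> enc y) = chi (\<Sum>j<K. (M\<^sup>T *\<^sub>v b) $ j * vec_first y K $ j) *
    (\<Prod>j\<in>{K..<n}. chi ((M\<^sup>T *\<^sub>v b) $ j * y $ j))"
proof -
  have Kn: "K \<le> n" using n_eq by simp
  have "b \<bullet> enc y = (M\<^sup>T *\<^sub>v b) \<bullet> y"
    unfolding enc_def by (rule transpose_vec_mult_scalar[OF M_carrier y b, symmetric])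
  also have "\<dots> = (\<Sum>j\<in>{0..<K}. (M\<^sup>T *\<^sub>v b) $ j * y $ j) + (\<Sum>j\<in>{K..<n}. (M\<^sup>T *\<^sub>v b) $ j * y $ j)"
    using y Kn by (simp add: scalar_prod_def sum.atLeastLessThan_concat)
  also have "(\<Sum>j\<in>{0..<K}. (M\<^sup>T *\<^sub>v b) $ j * y $ j) = (\<Sum>j<K. (M\<^sup>T *\<^sub>v b) $ j * vec_first y K $ j)"
    by (intro sum.cong) (auto simp: vec_first_def)
  finally show ?thesis
    by (simp add: chi_add chi_sum)
qed

text \<open>In unencoded coordinates everything factors over positions. Beyond the information
  positions each factor is a one-coordinate sum equal to 1 or 0, so the product merely tests that no
  position detects the error.\<close>

theorem inner_error:
  assumes x: "x \<in> carrier_vec n" and b: "b \<in> carrier_vec n"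
  shows "inner_state n c (code_state \<phi>) (apply_error \<gamma> p e n i (enc x) b (code_state \<psi>)) =
    \<gamma> ^ i * ((\<Sum>z\<in>carrier_vec K. cnj (\<phi> (z + vec_first x K)) * \<psi> z *
        chi (\<Sum>j<K. (M\<^sup>T *\<^sub>v b) $ j * z $ j)) *
      (if \<forall>j\<in>{K..<n}. undetected x b j then 1 else 0))"
proof -
  have Kn: "K \<le> n" using n_eq by simp
  \<comment> \<open>\<open>W j\<close> collects the amplitudes and the phase at position
    \<open>j\<close>, with the condition on \<open>y + x\<close> and \<open>y\<close> rewritten as
    one on \<open>x\<close> and \<open>y\<close>.\<close>
  define W where "W j y = (if j < K + h then 1 / of_nat CARD('a)
      else if j < n - c then (if x $ j = 0 then 1 else 0) * (if y = 0 then 1 else 0)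
      else (if x $ j = 0 then 1 / of_nat CARD('a) else 0)) * chi ((M\<^sup>T *\<^sub>v b) $ j * y)" for j and y :: 'a
  define f where "f z = cnj (\<phi> (z + vec_first x K)) * \<psi> z * chi (\<Sum>j<K. (M\<^sup>T *\<^sub>v b) $ j * z $ j)" for z
  have term_eq: "(\<Sum>r\<in>carrier_vec c. cnj (code_state \<phi> (enc (y + x), r)) *
        apply_error \<gamma> p e n i (enc x) b (code_state \<psi>) (enc (y + x), r)) =
      \<gamma> ^ i * (f (vec_first y K) * (\<Prod>j\<in>{K..<n}. W j (y $ j)))" if y: "y \<in> carrier_vec n" for y
  proof -
    have yx: "y + x \<in> carrier_vec n" using x y by simp
    have minus: "enc (y + x) - enc x = enc y"
      using enc_carrier[OF x] enc_carrier[OF y] by (auto simp: enc_add[OF y x] vec_eq_iff)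
    have first: "vec_first (y + x) K = vec_first y K + vec_first x K"
      using x y Kn by (auto simp: vec_first_def vec_eq_iff)
    have "(\<Sum>r\<in>carrier_vec c. cnj (code_state \<phi> (enc (y + x), r)) *
          apply_error \<gamma> p e n i (enc x) b (code_state \<psi>) (enc (y + x), r)) =
        (\<Sum>r\<in>carrier_vec c. \<gamma> ^ i * chi (b \<bullet> enc y) *
          (cnj (\<phi> (vec_first y K + vec_first x K)) * \<psi> (vec_first y K)) *
          (\<Prod>j\<in>{K..<n}. cnj (amp r j ((y + x) $ j)) * amp r j (y $ j)))"
      using x y yx by (intro sum.cong)
        (simp_all add: apply_error_code_state minus code_state_enc first prod.distrib)
    also have "\<dots> = \<gamma> ^ i * chi (b \<bullet> enc y) *
          (cnj (\<phi> (vec_first y K + vec_first x K)) * \<psi> (vec_first y K)) *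
        (\<Prod>j\<in>{K..<n}. if j < K + h then 1 / of_nat CARD('a)
          else if j < n - c then (if (y + x) $ j = 0 then 1 else 0) * (if y $ j = 0 then 1 else 0)
          else (if (y + x) $ j = y $ j then 1 / of_nat CARD('a) else 0))"
      by (simp only: sum_amp flip: sum_distrib_left)
    also have "\<dots> = \<gamma> ^ i * (f (vec_first y K) * ((\<Prod>j\<in>{K..<n}. if j < K + h then 1 / of_nat CARD('a)
          else if j < n - c then (if (y + x) $ j = 0 then 1 else 0) * (if y $ j = 0 then 1 else 0)
          else (if (y + x) $ j = y $ j then 1 / of_nat CARD('a) else 0)) *
          (\<Prod>j\<in>{K..<n}. chi ((M\<^sup>T *\<^sub>v b) $ j * y $ j))))"
      by (simp only: chi_enc[OF y b] f_def mult_ac)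
    also have "(\<Prod>j\<in>{K..<n}. if j < K + h then 1 / of_nat CARD('a)
          else if j < n - c then (if (y + x) $ j = 0 then 1 else 0) * (if y $ j = 0 then 1 else 0)
          else (if (y + x) $ j = y $ j then 1 / of_nat CARD('a) else 0)) *
          (\<Prod>j\<in>{K..<n}. chi ((M\<^sup>T *\<^sub>v b) $ j * y $ j)) = (\<Prod>j\<in>{K..<n}. W j (y $ j))"
      using x y by (auto simp: W_def simp flip: prod.distrib intro!: prod.cong)
    finally show ?thesis .
  qed
  \<comment> \<open>Orthogonality of characters handles the first \<open>h\<close> ancillas and the
    entangled positions; on the last \<open>h\<close> ancillas only \<open>y = 0\<close> survives
    and the phase is invisible.\<close>
  have sum_W: "(\<Sum>y\<in>UNIV. W j y) = (if undetected x b j then 1 else 0)" if "j \<in> {K..<n}" for j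
  proof -
    consider "j < K + h" | "K + h \<le> j" "j < n - c" | "n - c \<le> j" by linarith
    then show ?thesis
    proof cases
      case 2
      then have "W j y = (if y = 0 then if x $ j = 0 then 1 else 0 else 0)" for y
        by (auto simp: W_def)
      then show ?thesis using 2 by (simp add: undetected_def)
    qed (use that position_bounds in \<open>auto simp: W_def undetected_def sum_chi simp flip: sum_divide_distrib\<close>)
  qed
  \<comment> \<open>With labels written as \<open>enc (y + x)\<close>, removing the shift
    \<open>enc x\<close> leaves \<open>enc y\<close>.\<close>
  have shift: "bij_betw (\<lambda>y. enc (y + x)) (carrier_vec n) (carrier_vec n)"
  proof -
    have "bij_betw (\<lambda>y. y + x) (carrier_vec n) (carrier_vec n)"
      by (rule bij_betw_byWitness[of _ "\<lambda>y. y - x"]) (use x in \<open>auto simp: vec_eq_iff\<close>)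
    then show ?thesis
      using bij_betw_trans[OF _ bij_enc] by (fastforce simp: o_def)
  qed
  have "inner_state n c (code_state \<phi>) (apply_error \<gamma> p e n i (enc x) b (code_state \<psi>)) =
      (\<Sum>v\<in>carrier_vec n. \<Sum>r\<in>carrier_vec c. cnj (code_state \<phi> (v, r)) *
        apply_error \<gamma> p e n i (enc x) b (code_state \<psi>) (v, r))"
    unfolding inner_state_def sum.cartesian_product by (intro sum.cong) auto
  also have "\<dots> = (\<Sum>y\<in>carrier_vec n. \<Sum>r\<in>carrier_vec c. cnj (code_state \<phi> (enc (y + x), r)) *
        apply_error \<gamma> p e n i (enc x) b (code_state \<psi>) (enc (y + x), r))"
    by (rule sum.reindex_bij_betw[OF shift, symmetric])
  also have "\<dots> = \<gamma> ^ i * (\<Sum>y\<in>carrier_vec n. f (vec_first y K) * (\<Prod>j\<in>{K..<n}. W j (y $ j)))"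
    by (simp add: term_eq sum_distrib_left)
  also have "\<dots> = \<gamma> ^ i * ((\<Sum>z\<in>carrier_vec K. f z) * (\<Prod>j\<in>{K..<n}. \<Sum>y\<in>UNIV. W j y))"
    by (simp add: sum_carrier_vec_split[OF Kn])
  also have "(\<Prod>j\<in>{K..<n}. \<Sum>y\<in>UNIV. W j y) = (if \<forall>j\<in>{K..<n}. undetected x b j then 1 else 0)"
    using prod_if_ball[of "{K..<n}" "undetected x b", where 'b = complex] by (simp add: sum_W)
  finally show ?thesis by (simp add: f_def)
qed

section \<open>Minimum distance from the two classical codes\<close>

lemma transpose_M_0: "(M\<^sup>T *\<^sub>v 0\<^sub>v n) = 0\<^sub>v n"
  using M_carrier by auto

lemma phase_0: "(\<Sum>j<K. (M\<^sup>T *\<^sub>v 0\<^sub>v n) $ j * z $ j) = 0"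
  using position_bounds(1) by (intro sum.neutral) (simp add: transpose_M_0)

lemma undetected_0 [simp]: "j < n \<Longrightarrow> undetected (0\<^sub>v n) (0\<^sub>v n) j"
  by (simp add: undetected_def transpose_M_0)

lemma vec_first_0: "vec_first (0\<^sub>v n) K = 0\<^sub>v K"
  using n_eq by (auto simp: vec_first_def)

text \<open>The special case of the trivial error: encoding preserves inner products of information
  states.\<close>

lemma inner_code_state:
  "inner_state n c (code_state \<phi>) (code_state \<psi>) = (\<Sum>z\<in>carrier_vec K. cnj (\<phi> z) * \<psi> z)"
proof -
  have "inner_state n c (code_state \<phi>) (code_state \<psi>) =
      inner_state n c (code_state \<phi>) (apply_error \<gamma> p e n 0 (enc (0\<^sub>v n)) (0\<^sub>v n) (code_state \<psi>))"
    unfolding inner_state_def by (rule sum.cong) (auto simp: apply_error_code_state)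
  also have "\<dots> = (\<Sum>z\<in>carrier_vec K. cnj (\<phi> z) * \<psi> z)"
    by (subst inner_error) (auto simp: phase_0 vec_first_0 intro!: sum.cong)
  finally show ?thesis .
qed

lemma ea_code_eq:
  "ea_code n K c encoding_unitary = {code_state \<phi> | \<phi>. \<forall>x. x \<notin> carrier_vec K \<longrightarrow> \<phi> x = 0}"
  by (simp add: ea_code_def code_state_def)

lemma error_weight_ge:
  "card {j. j < n \<and> a $ j \<noteq> 0} \<le> error_weight n a b"
  "card {j. j < n \<and> b $ j \<noteq> 0} \<le> error_weight n a b"
  unfolding error_weight_def by (auto intro!: card_mono)

text \<open>By \<open>X\<close> and \<open>Z\<close>, an undetected error of weight below
  \<open>d\<close> has zero shift and zero phase vector. Conversely, the pure shift by
  \<open>enc x\<close> is undetected, has weight at most \<open>d\<close>, and yields a matrix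
  element 1 that violates the distance condition for any larger value.\<close>

theorem has_min_distance_css:
  assumes X: "\<And>x. \<lbrakk>x \<in> carrier_vec n; \<forall>j\<in>{K + h..<n}. x $ j = 0;
      card {j. j < n \<and> enc x $ j \<noteq> 0} < d\<rbrakk> \<Longrightarrow> x = 0\<^sub>v n"
    and Z: "\<And>b. \<lbrakk>b \<in> carrier_vec n; \<forall>j\<in>{K..<K + h} \<union> {n - c..<n}. (M\<^sup>T *\<^sub>v b) $ j = 0;
      card {j. j < n \<and> b $ j \<noteq> 0} < d\<rbrakk> \<Longrightarrow> b = 0\<^sub>v n"
    and x: "x \<in> carrier_vec n" "\<forall>j\<in>{K + h..<n}. x $ j = 0" "x \<noteq> 0\<^sub>v n"
      "card {j. j < n \<and> enc x $ j \<noteq> 0} \<le> d"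
      "K = 0 \<or> vec_first x K \<noteq> 0\<^sub>v K"
  shows "has_min_distance \<gamma> p e n K c (ea_code n K c encoding_unitary) d"
proof -
  have trivial: "x = 0\<^sub>v n \<and> b = 0\<^sub>v n"
    if "x \<in> carrier_vec n" "b \<in> carrier_vec n" "error_weight n (enc x) b < d"
      "\<forall>j\<in>{K..<n}. undetected x b j" for x b
  proof
    show "x = 0\<^sub>v n"
      using that error_weight_ge(1)[of "enc x" b] by (intro X) (auto simp: undetected_def)
    show "b = 0\<^sub>v n"
      using that error_weight_ge(2)[of b "enc x"] position_bounds by (intro Z) (auto simp: undetected_def)
  qed
  have weight0: "error_weight n (0\<^sub>v n :: 'a vec) (0\<^sub>v n :: 'a vec) = 0"
    by (simp add: error_weight_def)
  have "detects_below \<gamma> p e n K c (ea_code n K c encoding_unitary) d"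
  proof (cases "K = 0")
    case True
    have "inner_state n c (code_state \<phi>) (apply_error \<gamma> p e n i a b (code_state \<phi>)) = 0"
      if "a \<in> carrier_vec n" "b \<in> carrier_vec n" "1 \<le> error_weight n a b" "error_weight n a b < d"
      for \<phi> i a b
    proof -
      have "\<not> (\<forall>j\<in>{K..<n}. undetected (dec a) b j)"
        using trivial[of "dec a" b] that weight0 by (metis dec_carrier enc_0 enc_dec not_one_le_zero)
      then show ?thesis
        using inner_error[of "dec a" b \<phi> i \<phi>] that by auto
    qed
    then show ?thesis
      unfolding detects_below_def ea_code_eq if_P[OF True] by auto
  next
    case False
    have "inner_state n c (code_state \<phi>) (apply_error \<gamma> p e n i a b (code_state \<psi>)) = 0"
      if "inner_state n c (code_state \<phi>) (code_state \<psi>) = 0"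
        "a \<in> carrier_vec n" "b \<in> carrier_vec n" "error_weight n a b < d" for \<phi> \<psi> i a b
    proof (cases "\<forall>j\<in>{K..<n}. undetected (dec a) b j")
      case True
      then have "dec a = 0\<^sub>v n" "b = 0\<^sub>v n"
        using trivial[of "dec a" b] that by auto
      then have eq: "a = 0\<^sub>v n" "b = 0\<^sub>v n"
        using enc_dec[of a] that by auto
      have "(\<Sum>z\<in>carrier_vec K. cnj (\<phi> (z + vec_first (0\<^sub>v n) K)) * \<psi> z *
          chi (\<Sum>j<K. (M\<^sup>T *\<^sub>v 0\<^sub>v n) $ j * z $ j)) = (\<Sum>z\<in>carrier_vec K. cnj (\<phi> z) * \<psi> z)"
        by (intro sum.cong) (auto simp: phase_0 vec_first_0)
      then show ?thesis
        using inner_error[of "0\<^sub>v n" "0\<^sub>v n" \<phi> i \<psi>] that unfolding inner_code_state by (auto simp: eq)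
    next
      case False
      then show ?thesis
        using inner_error[of "dec a" b \<phi> i \<psi>] that by auto
    qed
    then show ?thesis
      using False by (auto simp: detects_below_def ea_code_eq)
  qed
  moreover have "d' \<le> d" if det: "detects_below \<gamma> p e n K c (ea_code n K c encoding_unitary) d'" for d'
  proof (rule ccontr)
    assume "\<not> d' \<le> d"
    have "{j. j < n \<and> (enc x $ j, 0\<^sub>v n $ j) \<noteq> (0, 0 :: 'a)} = {j. j < n \<and> enc x $ j \<noteq> 0}"
      by auto
    then have wt: "error_weight n (enc x) (0\<^sub>v n) = card {j. j < n \<and> enc x $ j \<noteq> 0}"
      by (simp add: error_weight_def)
    have und: "\<forall>j\<in>{K..<n}. undetected x (0\<^sub>v n) j"
      using x by (simp add: undetected_def transpose_M_0)
    \<comment> \<open>Basis information states: the shift moves the information label 0 to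
      \<open>vec_first x K\<close>. For \<open>K > 0\<close> these two labels differ, so the states
      are orthogonal; for \<open>K = 0\<close> they coincide and the error has positive
      weight.\<close>
    define \<delta> where "\<delta> v = (\<lambda>z. if z = v then 1 else 0 :: complex)" for v :: "'a vec"
    have code: "code_state (\<delta> v) \<in> ea_code n K c encoding_unitary" if "v \<in> carrier_vec K" for v
      using that by (auto simp: ea_code_eq \<delta>_def)
    have "(\<Sum>z\<in>carrier_vec K. cnj (\<delta> (vec_first x K) (z + vec_first x K)) * \<delta> (0\<^sub>v K) z *
          chi (\<Sum>j<K. (M\<^sup>T *\<^sub>v 0\<^sub>v n) $ j * z $ j)) =
        (\<Sum>z\<in>carrier_vec K. if z = (0\<^sub>v K :: 'a vec) then 1 else 0)"
      by (intro sum.cong) (auto simp: phase_0 \<delta>_def)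
    then have nz: "inner_state n c (code_state (\<delta> (vec_first x K)))
        (apply_error \<gamma> p e n 0 (enc x) (0\<^sub>v n) (code_state (\<delta> (0\<^sub>v K)))) = 1"
      using inner_error[OF x(1), of "0\<^sub>v n" "\<delta> (vec_first x K)" 0 "\<delta> (0\<^sub>v K)"] und by simp
    show False
    proof (cases "K = 0")
      case True
      have "enc x \<noteq> 0\<^sub>v n"
        using dec_enc[OF x(1)] dec_enc[of "0\<^sub>v n"] x(3) by auto
      then have "{j. j < n \<and> enc x $ j \<noteq> 0} \<noteq> {}"
        using enc_carrier[OF x(1)] by (auto simp: vec_eq_iff)
      then have "1 \<le> error_weight n (enc x) (0\<^sub>v n)"
        unfolding wt by (simp add: Suc_le_eq card_gt_0_iff)
      moreover have "vec_first x K = 0\<^sub>v K"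
        using True by auto
      moreover have "error_weight n (enc x) (0\<^sub>v n) < d'"
        using wt x(4) \<open>\<not> d' \<le> d\<close> by simp
      ultimately have "inner_state n c (code_state (\<delta> (0\<^sub>v K)))
        (apply_error \<gamma> p e n 0 (enc x) (0\<^sub>v n) (code_state (\<delta> (0\<^sub>v K)))) = 0"
        using det code[of "0\<^sub>v K"] x(1) unfolding detects_below_def if_P[OF True] by auto
      then show False
        using nz \<open>vec_first x K = 0\<^sub>v K\<close> by simp
    next
      case False
      have "inner_state n c (code_state (\<delta> (vec_first x K))) (code_state (\<delta> (0\<^sub>v K))) = 0"
        unfolding inner_code_state using False x(5) by (intro sum.neutral) (auto simp: \<delta>_def)
      moreover have "error_weight n (enc x) (0\<^sub>v n) < d'"
        using wt x(4) \<open>\<not> d' \<le> d\<close> by simp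
      ultimately have "inner_state n c (code_state (\<delta> (vec_first x K)))
        (apply_error \<gamma> p e n 0 (enc x) (0\<^sub>v n) (code_state (\<delta> (0\<^sub>v K)))) = 0"
        using det False code[of "vec_first x K"] code[of "0\<^sub>v K"] x(1)
        unfolding detects_below_def by auto
      then show False using nz by simp
    qed
  qed
  ultimately show ?thesis
    unfolding has_min_distance_def by blast
qed

end

section \<open>Reed-Solomon codes\<close>

locale grs_encoder = qudit_field p e \<gamma> field_type
  for p e :: nat and \<gamma> :: complex and field_type :: "'a::{field,finite} itself" +
  fixes K h c n :: nat and pt :: "nat \<Rightarrow> 'a"
  assumes n_eq: "n = K + 2 * h + c"
    and dim_pos: "K + h > 0"
    and inj_pt: "inj_on pt {..<n}"
    and pt_nonzero: "i < n \<Longrightarrow> pt i \<noteq> 0"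
begin

text \<open>
  The permutation of the exponents makes the columns of the information positions and the first \<open>h\<close>
  ancillas fill \<open>{c..<c + h + K}\<close>, and those of the first \<open>h\<close> ancillas and the entangled positions
  fill \<open>{0..<c + h}\<close>.
\<close>

definition expo :: "nat \<Rightarrow> nat" where
  "expo j = (if j < K then h + c + j else if j < K + h then j + c - K
    else if j < K + 2 * h then c + j else j - (K + 2 * h))"

definition vandermonde :: "'a mat" where
  "vandermonde = mat n n (\<lambda>(i, j). pt i ^ expo j)"

definition row_poly :: "'a vec \<Rightarrow> 'a poly" where
  "row_poly y = (\<Sum>j<n. monom (y $ j) (expo j))"

section \<open>The Vandermonde matrix as polynomial evaluation\<close>

lemma inj_expo: "inj_on expo {..<n}"
  by (auto simp: inj_on_def expo_def n_eq split: if_splits)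

lemma expo_less: "j < n \<Longrightarrow> expo j < n"
  by (auto simp: expo_def n_eq)

lemma bij_expo: "bij_betw expo {..<n} {..<n}"
  using inj_expo expo_less endo_inj_surj[of "{..<n}" expo] by (auto simp: bij_betw_def image_subset_iff)

lemma vandermonde_carrier: "vandermonde \<in> carrier_mat n n"
  by (simp add: vandermonde_def)

lemma vandermonde_mult:
  assumes "y \<in> carrier_vec n" "i < n"
  shows "(vandermonde *\<^sub>v y) $ i = poly (row_poly y) (pt i)"
  using assms by (auto simp: vandermonde_def scalar_prod_def row_poly_def poly_sum poly_monom
      atLeast0LessThan mult.commute intro!: sum.cong)

lemma coeff_row_poly: "j < n \<Longrightarrow> coeff (row_poly y) (expo j) = y $ j"
  unfolding row_poly_def coeff_sum coeff_monom
  by (subst sum.cong[OF refl, of _ _ "\<lambda>i. if i = j then y $ j else 0"])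
     (auto dest: inj_onD[OF inj_expo])

lemma degree_row_poly: "degree (row_poly y) < n"
proof -
  have "degree (row_poly y) \<le> n - 1"
    unfolding row_poly_def
    using expo_less by (intro degree_sum_le order.trans[OF degree_monom_le]) (fastforce)+
  then show ?thesis using n_eq dim_pos by linarith
qed

lemma poly_eq_0_of_roots:
  assumes "degree P < card I" "I \<subseteq> {..<n}" "\<And>i. i \<in> I \<Longrightarrow> poly P (pt i) = 0"
  shows "P = 0"
proof (rule ccontr)
  assume P: "P \<noteq> 0"
  have "card I = card (pt ` I)"
    using assms(2) inj_pt by (metis card_image inj_on_subset)
  also have "\<dots> \<le> card {x. poly P x = 0}"
    using assms(3) poly_roots_finite[OF P] by (intro card_mono) auto
  also have "\<dots> \<le> degree P"
    by (rule card_poly_roots_bound[OF P])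
  finally show False using assms(1) by simp
qed

lemma inj_vandermonde: "inj_on (\<lambda>y. vandermonde *\<^sub>v y) (carrier_vec n)"
proof (rule inj_onI)
  fix y z assume y: "y \<in> carrier_vec n" and z: "z \<in> carrier_vec n"
    and eq: "vandermonde *\<^sub>v y = vandermonde *\<^sub>v z"
  have "row_poly y - row_poly z = 0"
  proof (rule poly_eq_0_of_roots)
    show "degree (row_poly y - row_poly z) < card {..<n}"
      using degree_row_poly by (simp add: degree_diff_less)
    show "poly (row_poly y - row_poly z) (pt i) = 0" if "i \<in> {..<n}" for i
      using that vandermonde_mult[OF y, of i] vandermonde_mult[OF z, of i] eq by simp
  qed simp
  then show "y = z"
    using y z coeff_row_poly[of _ y] coeff_row_poly[of _ z] by (intro eq_vecI) auto
qed

sublocale css_encoder p e \<gamma> field_type K h c n vandermonde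
  by unfold_locales (rule n_eq vandermonde_carrier inj_vandermonde)+

text \<open>The allowed exponents fill \<open>{c..<c + h + K}\<close>, so the word evaluates
  \<open>X^c * Q\<close> with \<open>Q\<close> of degree below \<open>K + h\<close>. Low weight
  gives at least \<open>K + h\<close> zeros, all of them roots of \<open>Q\<close> because the nodes
  are non-zero.\<close>

lemma X_weight:
  assumes y: "y \<in> carrier_vec n" "\<forall>j\<in>{K + h..<n}. y $ j = 0"
    and wt: "card {i. i < n \<and> enc y $ i \<noteq> 0} < h + c + 1"
  shows "y = 0\<^sub>v n"
proof -
  define Q where "Q = (\<Sum>j<K + h. monom (y $ j) (expo j - c))"
  have Kh: "K + h \<le> n" by (rule position_bounds)
  have row: "row_poly y = monom 1 c * Q"
  proof -
    have "row_poly y = (\<Sum>j<K + h. monom (y $ j) (expo j))"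
      unfolding row_poly_def using y(2) Kh by (intro sum.mono_neutral_right) auto
    also have "\<dots> = monom 1 c * Q"
      unfolding Q_def sum_distrib_left
      by (intro sum.cong) (auto simp: mult_monom expo_def add_ac)
    finally show ?thesis .
  qed
  let ?I = "{i. i < n \<and> enc y $ i = 0}"
  have "Q = 0"
  proof (rule poly_eq_0_of_roots)
    have "degree Q \<le> K + h - 1"
      unfolding Q_def using dim_pos
      by (intro degree_sum_le) (auto intro!: order.trans[OF degree_monom_le] simp: expo_def)
    moreover have "card ?I + card {i. i < n \<and> enc y $ i \<noteq> 0} = n"
    proof -
      have "?I \<union> {i. i < n \<and> enc y $ i \<noteq> 0} = {..<n}" by auto
      then show ?thesis
        by (subst card_Un_disjoint[symmetric]) auto
    qed
    ultimately show "degree Q < card ?I"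
      using wt n_eq dim_pos by linarith
    show "poly Q (pt i) = 0" if "i \<in> ?I" for i
      using that vandermonde_mult[OF y(1), of i] pt_nonzero[of i]
      by (simp add: enc_def row poly_monom)
  qed auto
  then have "y $ j = 0" if "j < n" for j
    using coeff_row_poly[OF that, of y] by (simp add: row)
  then show ?thesis
    using y by auto
qed

text \<open>The word is orthogonal to evaluations of all polynomials of degree below
  \<open>h + c\<close>. If its support had at most \<open>h + c\<close> positions, a polynomial
  vanishing at all support nodes but one would isolate a single non-zero entry.\<close>

lemma Z_weight:
  assumes b: "b \<in> carrier_vec n"
    and orth: "\<forall>j\<in>{K..<K + h} \<union> {n - c..<n}. (vandermonde\<^sup>T *\<^sub>v b) $ j = 0"
    and wt: "card {i. i < n \<and> b $ i \<noteq> 0} < h + c + 1"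
  shows "b = 0\<^sub>v n"
proof (rule ccontr)
  assume "b \<noteq> 0\<^sub>v n"
  then obtain m where m: "m < n" "b $ m \<noteq> 0"
    using b by (auto simp: vec_eq_iff)
  have moment: "(\<Sum>i<n. b $ i * pt i ^ s) = 0" if "s < h + c" for s
  proof -
    \<comment> \<open>Inverse of \<open>expo\<close> on exponents below \<open>h + c\<close>:
      entangled positions for \<open>s < c\<close>, the first \<open>h\<close> ancillas
      otherwise.\<close>
    define j where "j = (if s < c then s + K + 2 * h else s - c + K)"
    have j: "j \<in> {K..<K + h} \<union> {n - c..<n}" "j < n" "expo j = s"
      using that n_eq by (auto simp: j_def expo_def)
    have "(vandermonde\<^sup>T *\<^sub>v b) $ j = (\<Sum>i<n. b $ i * pt i ^ expo j)"
      using j(2) b by (auto simp: vandermonde_def scalar_prod_def atLeast0LessThan mult.commute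
          intro!: sum.cong)
    then show ?thesis
      using orth j by auto
  qed
  define S where "S = {i. i < n \<and> b $ i \<noteq> 0} - {m}"
  define P where "P = (\<Prod>i\<in>S. [:- pt i, 1:])"
  have "degree P \<le> card S"
    unfolding P_def using degree_prod_sum_le[of S "\<lambda>i. [:- pt i, 1:]"] by (simp add: S_def)
  moreover have "card S < h + c"
  proof -
    have "card S < card {i. i < n \<and> b $ i \<noteq> 0}"
      unfolding S_def using m by (intro card_Diff1_less) auto
    then show ?thesis using wt by simp
  qed
  ultimately have deg: "degree P < h + c" by simp
  have "(\<Sum>i<n. b $ i * poly P (pt i)) = (\<Sum>s\<le>degree P. coeff P s * (\<Sum>i<n. b $ i * pt i ^ s))"
    unfolding poly_altdef sum_distrib_left
    by (subst sum.swap) (simp add: mult_ac)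
  also have "\<dots> = 0"
    using deg moment by (intro sum.neutral) auto
  also have "(\<Sum>i<n. b $ i * poly P (pt i)) = (\<Sum>i<n. if i = m then b $ m * poly P (pt m) else 0)"
    by (intro sum.cong) (auto simp: P_def poly_prod S_def)
  finally have "poly P (pt m) = 0"
    using m by simp
  moreover have "finite S" by (simp add: S_def)
  ultimately obtain i where "i \<in> S" "pt i = pt m"
    unfolding P_def poly_prod by (force simp: prod_zero_iff)
  then show False
    using m inj_pt by (auto simp: S_def inj_on_def)
qed

text \<open>Evaluating \<open>X^c\<close> times a monic polynomial with \<open>K + h - 1\<close>
  prescribed nodes as roots leaves at most \<open>n - (K + h - 1) = h + c + 1\<close> non-zero
  entries.\<close>

lemma min_weight_word:
  "\<exists>y\<in>carrier_vec n. (\<forall>j\<in>{K + h..<n}. y $ j = 0) \<and> y \<noteq> 0\<^sub>v n \<and>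
    card {i. i < n \<and> enc y $ i \<noteq> 0} \<le> h + c + 1 \<and> (K = 0 \<or> vec_first y K \<noteq> 0\<^sub>v K)"
proof -
  define Q where "Q = (\<Prod>i<K + h - 1. [:- pt i, 1:])"
  define P where "P = monom 1 c * Q"
  define y where "y = vec n (\<lambda>j. coeff P (expo j))"
  have y: "y \<in> carrier_vec n" by (simp add: y_def)
  have degQ: "degree Q = K + h - 1"
    unfolding Q_def by (simp add: degree_prod_eq_sum_degree)
  have leadQ: "lead_coeff Q = 1"
    unfolding Q_def lead_coeff_prod by simp
  have coeffP: "coeff P s = (if s < c then 0 else coeff Q (s - c))" for s
    by (simp add: P_def coeff_monom_mult)
  have "row_poly y = (\<Sum>j<n. monom (coeff P (expo j)) (expo j))"
    unfolding row_poly_def by (intro sum.cong) (auto simp: y_def)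
  also have "\<dots> = (\<Sum>s<n. monom (coeff P s) s)"
    by (rule sum.reindex_bij_betw[OF bij_expo])
  also have "\<dots> = P"
  proof (rule poly_eqI)
    fix s
    have "coeff P s = 0" if "s \<ge> n"
    proof -
      have "degree Q < s - c"
        using that degQ n_eq dim_pos by linarith
      then show ?thesis
        by (simp add: coeffP coeff_eq_0)
    qed
    then show "coeff (\<Sum>s<n. monom (coeff P s) s) s = coeff P s"
      by (auto simp: coeff_sum)
  qed
  finally have row: "row_poly y = P" .
  have top: "coeff P (c + (K + h - 1)) = 1"
    using leadQ by (simp add: coeffP degQ)
  have "y $ j = 0" if "j \<in> {K + h..<n}" for j
    using that degQ n_eq dim_pos by (auto simp: y_def coeffP expo_def coeff_eq_0)
  moreover
  \<comment> \<open>The position carrying the leading exponent \<open>c + K + h - 1\<close>. It is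
    the last information position when \<open>K > 0\<close>, which makes the information part
    non-zero.\<close>
  define m where "m = (if K = 0 then h - 1 else K - 1)"
  have m: "m < n" "K = 0 \<or> m < K" "expo m = c + (K + h - 1)"
    using dim_pos n_eq by (auto simp: m_def expo_def)
  then have ym: "y $ m = 1"
    using top by (simp add: y_def)
  have "y \<noteq> 0\<^sub>v n"
    using m(1) ym by auto
  moreover have "K = 0 \<or> vec_first y K \<noteq> 0\<^sub>v K"
    using m(2) ym by (auto simp: vec_first_def dest!: arg_cong[of _ _ "\<lambda>v. v $ m"])
  moreover have "card {i. i < n \<and> enc y $ i \<noteq> 0} \<le> h + c + 1"
  proof -
    have "enc y $ i = 0" if "i < K + h - 1" for i
    proof -
      have "i < n" using that n_eq by simp
      moreover have "poly Q (pt i) = 0"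
        using that by (auto simp: Q_def poly_prod)
      ultimately show ?thesis
        using vandermonde_mult[OF y, of i] by (simp add: enc_def row P_def)
    qed
    then have "K + h - 1 \<le> i" if "enc y $ i \<noteq> 0" for i
      using that not_le by blast
    then have "{i. i < n \<and> enc y $ i \<noteq> 0} \<subseteq> {K + h - 1..<n}"
      by auto
    then have "card {i. i < n \<and> enc y $ i \<noteq> 0} \<le> card {K + h - 1..<n}"
      by (intro card_mono) auto
    then show ?thesis using n_eq dim_pos by simp
  qed
  ultimately show ?thesis
    using y by blast
qed

text \<open>From \<open>n = K + 2 * h + c\<close> one gets \<open>n + c - K = 2 * (h + c)\<close>,
  which is the MDS equality for distance \<open>h + c + 1\<close>.\<close>

theorem is_mds: "is_mds_eaqecc \<gamma> p e n K (h + c + 1) c (ea_code n K c encoding_unitary)"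
proof -
  obtain y where "y \<in> carrier_vec n" "\<forall>j\<in>{K + h..<n}. y $ j = 0" "y \<noteq> 0\<^sub>v n"
    "card {i. i < n \<and> enc y $ i \<noteq> 0} \<le> h + c + 1" "K = 0 \<or> vec_first y K \<noteq> 0\<^sub>v K"
    using min_weight_word by blast
  then have "has_min_distance \<gamma> p e n K c (ea_code n K c encoding_unitary) (h + c + 1)"
    by (intro has_min_distance_css X_weight Z_weight)
  then show ?thesis
    using n_eq unitary_encoding by (auto simp: is_mds_eaqecc_def is_eaqecc_def)
qed

end

section \<open>Choice of nodes and parameters\<close>

theorem theorem6:
  fixes p e l n k h :: nat and \<gamma> :: complex
  assumes "prime p" and "odd p" and "e \<ge> 1"
    and "CARD('a::{field,finite}) = p ^ e"
    and "primitive_root_of_unity p \<gamma>"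
    and "l \<le> e - 1" and "2 * l dvd e"
    and "n > 0" and "n \<le> p ^ l"
    and "1 \<le> k" and "k \<le> n div 2" and "h \<le> k"
  shows "\<exists>Q :: 'a state set. is_mds_eaqecc \<gamma> p e n (k - h) (n - k + 1) (n - k - h) Q"
proof -
  have "p > 1" using assms(1) prime_gt_1_nat by blast
  \<comment> \<open>Since \<open>l < e\<close>, the bound \<open>n \<le> p ^ l\<close> leaves room
    for \<open>n\<close> distinct non-zero nodes in the field.\<close>
  then have "p ^ l < p ^ e"
    using assms(3,6) by (intro power_strict_increasing) auto
  then have "n \<le> card (UNIV - {0 :: 'a})"
    using assms(4,9) by (simp add: card_Diff_singleton)
  then obtain pts :: "'a set" where pts: "pts \<subseteq> UNIV - {0}" "card pts = n"
    by (meson obtain_subset_with_card_n)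
  then obtain pt where pt: "bij_betw pt {..<n} pts"
    using ex_bij_betw_nat_finite[of pts] by (auto simp: atLeast0LessThan)
  \<comment> \<open>The natural-number subtractions are exact because \<open>h \<le> k\<close> and
    \<open>k + h \<le> 2 * k \<le> n\<close>; the dimension \<open>K + h\<close> becomes
    \<open>k\<close>.\<close>
  interpret grs_encoder p e \<gamma> "TYPE('a)" "k - h" h "n - k - h" n pt
  proof
    show "pt i \<noteq> 0" if "i < n" for i
      using that pt pts by (auto simp: bij_betw_def)
    show "inj_on pt {..<n}"
      using pt by (rule bij_betw_imp_inj_on)
  qed (use assms in auto)
  have "h + (n - k - h) + 1 = n - k + 1"
    using assms(11,12) by simp
  then show ?thesis
    using is_mds by metis
qed

end
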